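(* Let $0<\theta<1$ and let $a<a^{\star}$ be fixed. Consider pairs $(c,M)$ with $$c^{1-\theta}<\ln M<\tfrac12 c.$$ Then there exist constants $\alpha>0$ and $c_0>1$ such that for every such pair with $c>c_0$, $$F(c,M)>\exp\left\{M\left(1-\frac{\ln M+\ln^{(2)}M+\ln^{(3)}M}{c+1}+\frac{a-\alpha+\ln c+\ln^{(2)}c}{c+1}\right)\right\}.$$
   Context: $a^{\star}=1+\ln(e-1)$; $\ln^{(1)}=\ln$, $\ln^{(k+1)}=\ln\circ\ln^{(k)}$. For real $c>1$ and $M>0$, let $r=[c]$ and $m_i=\dfrac{(e-1)e^{c-i}}{c-i}$ for $0\le i\le r-1$, and $$F(c,M)=\sum_{\mathbf z}\prod_{i=0}^{r-1}\frac{m_i^{z_i}}{z_i!},$$ the sum over all nonnegative integer vectors $\mathbf z=(z_0,\dots,z_{r-1})$ with $cz_0+(c-1)z_1+\cdots+(c-r+1)z_{r-1}<M$. *)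

theory Defs
  imports Complex_Main "HOL-Library.FuncSet"
begin

definition a_star :: real where
  "a_star = 1 + ln (exp 1 - 1)"

abbreviation iter_ln :: "nat \<Rightarrow> real \<Rightarrow> real" where
  "iter_ln k \<equiv> ln ^^ k"

definition rr :: "real \<Rightarrow> nat" where
  "rr c = nat \<lfloor>c\<rfloor>"

definition mm :: "real \<Rightarrow> nat \<Rightarrow> real" where
  "mm c i = (exp 1 - 1) * exp (c - real i) / (c - real i)"

text \<open>A vector $(z_0, \dots, z_{r-1})$ of nonnegative integers is an extensional function
  on the index set \<open>{..<r}\<close>, so that distinct elements below are distinct vectors.\<close>

definition Zset :: "real \<Rightarrow> real \<Rightarrow> (nat \<Rightarrow> nat) set" where
  "Zset c M = {z \<in> {..<rr c} \<rightarrow>\<^sub>E UNIV. (\<Sum>i<rr c. (c - real i) * real (z i)) < M}"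

definition F :: "real \<Rightarrow> real \<Rightarrow> real" where
  "F c M = (\<Sum>z\<in>Zset c M. \<Prod>i<rr c. mm c i ^ z i / fact (z i))"

text \<open>The index set is finite, so the sum defining \<open>F\<close> is a genuine one
  (a \<open>sum\<close> over an infinite set would be 0 by convention).\<close>

lemma finite_Zset:
  assumes "c > 1"
  shows "finite (Zset c M)"
proof -
  have ge1: "c - real i \<ge> 1" if "i < rr c" for i
    using that assms unfolding rr_def by linarith
  have "Zset c M \<subseteq> {..<rr c} \<rightarrow>\<^sub>E {..nat \<lceil>M\<rceil>}"
  proof
    fix z assume z: "z \<in> Zset c M"
    have "z i \<le> nat \<lceil>M\<rceil>" if i: "i < rr c" for i
    proof -
      have "real (z i) \<le> (c - real i) * real (z i)"
        using mult_right_mono[OF ge1[OF i], of "real (z i)"] by simp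
      also have "\<dots> \<le> (\<Sum>j<rr c. (c - real j) * real (z j))"
        using i ge1 by (intro member_le_sum) (auto intro!: mult_nonneg_nonneg dest!: ge1)
      also have "\<dots> < M"
        using z by (simp add: Zset_def)
      finally show ?thesis by linarith
    qed
    then show "z \<in> {..<rr c} \<rightarrow>\<^sub>E {..nat \<lceil>M\<rceil>}"
      using z by (auto simp: Zset_def PiE_iff)
  qed
  then show ?thesis
    by (rule finite_subset) (intro finite_PiE, auto)
qed

end

theory Submission
  imports Defs "HOL-Real_Asymp.Real_Asymp"
begin

text \<open>
  A single term of \<open>F\<close> suffices. With \<open>L = ln M\<close>, the maximal term spreads
  its mass over roughly the first \<open>k = c / L\<close> coordinates, so take \<open>z i = n\<close> for
  \<open>i < k\<close> and \<open>z i = 0\<close> otherwise, where \<open>n\<close> is as large as the constraint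
  \<open>n * S < M\<close> with \<open>S = c + (c - 1) + \<dots> + (c - k + 1)\<close> permits. The logarithm of this term
  is at least \<open>n * S - n * k * ln (c * n)\<close>, which is
  \<open>M * (1 - (L + ln L - ln c + O(1)) / (c + 1))\<close>. The terms \<open>ln (ln L)\<close> and \<open>ln (ln c)\<close> of the
  claim differ by a bounded amount, because \<open>(1 - \<theta>) * ln c < ln L < ln c\<close>,
  and bounded amounts are absorbed by \<open>\<alpha>\<close>.
\<close>

text \<open>Every summand of \<open>F\<close> is nonnegative, because \<open>c - real i > 0\<close>
  for \<open>i < rr c\<close>, so one admissible vector already bounds the sum from below.\<close>

lemma F_ge_uniform_term:
  assumes c: "c > 1" and k: "k \<le> rr c"
    and nS: "real n * (\<Sum>i<k. c - real i) < M"
  shows "(\<Prod>i<k. mm c i ^ n / fact n) \<le> F c M"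
proof -
  define z where "z = restrict (\<lambda>i. if i < k then n else 0) {..<rr c}"
  have sub: "{..<k} \<subseteq> {..<rr c}" using k by auto
  have pos: "c - real i > 0" if "i < rr c" for i
    using that c unfolding rr_def by linarith
  have "(\<Sum>i<rr c. (c - real i) * real (z i)) = (\<Sum>i<k. (c - real i) * real (z i))"
    using sub by (intro sum.mono_neutral_right) (auto simp: z_def)
  also have "\<dots> = (\<Sum>i<k. (c - real i) * real n)"
    using k by (intro sum.cong) (auto simp: z_def)
  also have "\<dots> < M" using nS by (simp add: sum_distrib_left mult.commute)
  finally have mem: "z \<in> Zset c M" by (auto simp: Zset_def z_def)
  have "(\<Prod>i<rr c. mm c i ^ z i / fact (z i)) = (\<Prod>i<k. mm c i ^ z i / fact (z i))"
    using sub by (intro prod.mono_neutral_right) (auto simp: z_def)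
  also have "\<dots> = (\<Prod>i<k. mm c i ^ n / fact n)"
    using k by (intro prod.cong) (auto simp: z_def)
  finally have eq: "(\<Prod>i<k. mm c i ^ n / fact n) = (\<Prod>i<rr c. mm c i ^ z i / fact (z i))" ..
  show ?thesis
    unfolding eq F_def using mem finite_Zset[OF c] pos
    by (intro member_le_sum[where f = "\<lambda>z. \<Prod>i<rr c. mm c i ^ z i / fact (z i)"] prod_nonneg)
       (auto simp: mm_def intro!: divide_nonneg_pos zero_le_power mult_nonneg_nonneg less_imp_le)
qed

text \<open>Combines \<open>exp 1 - 1 \<ge> 1\<close>, \<open>c - real i \<le> c\<close> and
  \<open>fact n \<le> n ^ n\<close>. For \<open>i < k\<close> with \<open>k\<close> about
  \<open>c / L\<close>, each loses at most a bounded factor per unit of \<open>n\<close>. As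
  \<open>n * k\<close> is of order \<open>M / c\<close>, the exponent loses only O(M / c).\<close>

lemma mm_power_div_fact_ge:
  assumes "c > real i" and n: "n \<ge> 1"
  shows "exp (real n * (c - real i) - real n * ln (c * real n)) \<le> mm c i ^ n / fact n"
proof -
  have c: "c > 0" and i: "c - real i > 0" using assms by linarith+
  have e: "exp 1 - 1 \<ge> (1::real)" using exp_ge_add_one_self[of 1] by simp
  have "exp (real n * (c - real i) - real n * ln (c * real n))
      = (exp (c - real i - ln (c * real n))) ^ n"
    by (simp add: exp_of_nat_mult[symmetric] algebra_simps)
  also have "exp (c - real i - ln (c * real n)) = exp (c - real i) / c / real n"
    using c n by (simp add: exp_diff)
  also have "(exp (c - real i) / c / real n) ^ n = (exp (c - real i) / c) ^ n / real n ^ n"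
    by (simp add: power_divide power_mult_distrib)
  also have "\<dots> \<le> mm c i ^ n / fact n"
  proof (rule frac_le)
    have "exp (c - real i) / c \<le> exp (c - real i) / (c - real i)"
      using i c by (intro divide_left_mono) auto
    also have "\<dots> \<le> mm c i"
      using mult_right_mono[OF e, of "exp (c - real i)"] i
      by (auto simp: mm_def intro!: divide_right_mono)
    finally show "(exp (c - real i) / c) ^ n \<le> mm c i ^ n"
      using c by (intro power_mono) auto
    then show "0 \<le> mm c i ^ n" using c by (meson divide_nonneg_pos exp_ge_zero order_trans zero_le_power)
    show "(fact n :: real) \<le> real n ^ n" using fact_le_power[of n, where 'a = real] by simp
  qed auto
  finally show ?thesis .
qed

lemma F_ge_exp:
  assumes c: "c > 1" and k: "k \<le> rr c" and n: "n \<ge> 1"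
    and nS: "real n * (\<Sum>i<k. c - real i) < M"
  shows "exp (real n * (\<Sum>i<k. c - real i) - real n * real k * ln (c * real n)) \<le> F c M"
proof -
  have "real n * (\<Sum>i<k. c - real i) - real n * real k * ln (c * real n)
     = (\<Sum>i<k. real n * (c - real i) - real n * ln (c * real n))"
    by (simp only: sum_subtractf sum_distrib_left[symmetric] sum_constant card_lessThan)
  then have "exp (real n * (\<Sum>i<k. c - real i) - real n * real k * ln (c * real n))
     = (\<Prod>i<k. exp (real n * (c - real i) - real n * ln (c * real n)))"
    by (simp add: exp_sum)
  also have "\<dots> \<le> (\<Prod>i<k. mm c i ^ n / fact n)"
  proof (rule prod_mono)
    fix i assume "i \<in> {..<k}"
    then have "c > real i" using k c unfolding rr_def lessThan_iff by linarith
    then show "0 \<le> exp (real n * (c - real i) - real n * ln (c * real n)) \<and>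
        exp (real n * (c - real i) - real n * ln (c * real n)) \<le> mm c i ^ n / fact n"
      using mm_power_div_fact_ge n by simp
  qed
  also have "\<dots> \<le> F c M" using F_ge_uniform_term[OF c k nS] .
  finally show ?thesis .
qed

lemma sum_first_terms_arith:
  "(\<Sum>i<k. c - real i) = real k * (c - (real k - 1) / 2)"
  by (induction k) (auto simp: field_simps)

text \<open>The hypothesis \<open>c\<^sup>2 * (c + 1) < M\<close> keeps the loss from rounding
  \<open>n\<close> to an integer below \<open>M / (c + 1)\<close>. The constant 6 is 4 (simplifying
  the main loss) + 1 (rounding) + 1 (a bound for \<open>ln 2\<close>).\<close>

lemma F_lower_bound:
  fixes c M :: real
  assumes c: "c \<ge> 4" and L2: "ln M \<ge> 2" and Lc: "ln M < c / 2"
    and M: "c\<^sup>2 * (c + 1) < M"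
  shows "F c M \<ge> exp (M * (1 - (ln M + ln (ln M) - ln c + 6) / (c + 1)))"
proof -
  define L where "L = ln M"
  \<comment> \<open>Trade-off: \<open>k\<close> coordinates lower \<open>ln (c * n)\<close> by about
    \<open>ln k\<close>, but lower the average weight \<open>S / k\<close> by about
    \<open>k / 2\<close>. At \<open>k\<close> near \<open>c / L\<close> this gains
    \<open>ln c - ln L\<close> at bounded cost.\<close>
  define k where "k = nat \<lceil>c / L\<rceil>"
  define S where "S = (\<Sum>i<k. c - real i)"
  \<comment> \<open>The largest integer with \<open>n * S < M\<close>; ceiling minus one respects
    the strict inequality even when \<open>M / S\<close> is an integer.\<close>
  define n where "n = nat (\<lceil>M / S\<rceil> - 1)"
  define X where "X = ln (2 * M * L / c)"
  have L: "L \<ge> 2" "L < c / 2" using L2 Lc by (auto simp: L_def)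
  have M0: "M > 0" using M c by (smt (verit) mult_nonneg_nonneg zero_le_power2)
  have cL2: "c / L > 2" using L c by (simp add: field_simps)
  have k_ge: "c / L \<le> real k" and k_le: "real k < c / L + 1"
    using cL2 unfolding k_def by linarith+
  have cL: "c / L \<le> c / 2" using L c by (intro divide_left_mono) auto
  have kr: "k \<le> rr c" using k_le cL c unfolding rr_def by linarith
  have k_pos: "real k > 0" using k_ge cL2 by linarith
  have S_eq: "S = real k * (c - (real k - 1) / 2)"
    unfolding S_def by (rule sum_first_terms_arith)
  have S_ge: "S \<ge> real k * (c * (1 - 1 / (2 * L)))"
  proof -
    have "c * (1 - 1 / (2 * L)) = c - (c / L) / 2" using L by (simp add: field_simps)
    also have "\<dots> \<le> c - (real k - 1) / 2" using k_le by simp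
    finally show ?thesis unfolding S_eq using k_pos by (intro mult_left_mono) auto
  qed
  have half: "1 - 1 / (2 * L) \<ge> 1 / 2" using L by (simp add: field_simps)
  \<comment> \<open>This cruder bound serves inside the logarithm, where the factor 2 costs only
    \<open>ln 2\<close>.\<close>
  have S_ge2: "S \<ge> real k * c / 2"
  proof -
    have "real k * c / 2 = real k * (c * (1 / 2))" by simp
    also have "\<dots> \<le> real k * (c * (1 - 1 / (2 * L)))"
      using half k_pos c by (intro mult_left_mono) auto
    finally show ?thesis using S_ge by linarith
  qed
  have S_pos: "S > 0" using S_ge2 k_pos c by (smt (verit) divide_pos_pos mult_pos_pos)
  have S_le: "S \<le> c\<^sup>2"
  proof -
    have kc: "real k \<le> c" using k_le cL c by linarith
    moreover have "c - (real k - 1) / 2 \<le> c" using k_pos by simp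
    moreover have "c - (real k - 1) / 2 \<ge> 0" using kc c by (simp add: field_simps)
    ultimately show ?thesis unfolding S_eq power2_eq_square using kc k_pos c
      by (intro mult_mono) auto
  qed
  have S_small: "S * (c + 1) < M"
    using mult_right_mono[OF S_le, of "c + 1"] c M by linarith
  then have "S < M" using S_pos c by (smt (verit) mult_left_mono mult_cancel_left1)
  then have MS: "M / S > 1" using S_pos by simp
  have n_lt: "real n < M / S" and n_ge: "real n \<ge> M / S - 1" and n1: "n \<ge> 1"
    using MS unfolding n_def by linarith+
  have nS: "real n * S < M" and nS2: "real n * S \<ge> M - S"
    using n_lt n_ge S_pos by (auto simp: field_simps)
  have F1: "exp (real n * S - real n * real k * ln (c * real n)) \<le> F c M"
    using F_ge_exp[of c k n M] c kr n1 nS unfolding S_def by simp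
  have kS: "real k / S \<le> (1 + 1 / L) / c"
  proof -
    \<comment> \<open>The product is \<open>1 + 1 / (2 * L) - 1 / (2 * L\<^sup>2)\<close>, at least
      1 as soon as \<open>L \<ge> 1\<close>.\<close>
    have "1 \<le> (1 + 1 / L) * (1 - 1 / (2 * L))" using L by (simp add: field_simps)
    then have "real k * c * 1 \<le> real k * c * ((1 + 1 / L) * (1 - 1 / (2 * L)))"
      using k_pos c by (intro mult_left_mono) auto
    also have "\<dots> = (1 + 1 / L) * (real k * (c * (1 - 1 / (2 * L))))" by (simp only: mult_ac)
    also have "\<dots> \<le> (1 + 1 / L) * S" using S_ge L by (intro mult_left_mono) auto
    finally show ?thesis using S_pos c by (simp add: field_simps)
  qed
  have cn: "c * real n \<le> 2 * M * L / c"
  proof -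
    have "c * real n \<le> c * (M / S)" using n_lt c by (intro mult_left_mono) auto
    also have "\<dots> \<le> c * (M / (real k * c / 2))"
      using S_ge2 S_pos k_pos c M0 by (intro mult_left_mono divide_left_mono) auto
    also have "\<dots> = 2 * M / real k" using c k_pos by (simp add: field_simps)
    also have "\<dots> \<le> 2 * M / (c / L)"
      using k_ge k_pos M0 L c by (intro divide_left_mono) auto
    finally show ?thesis by simp
  qed
  have cn1: "c * real n \<ge> 1" using n1 c mult_mono[of 1 c 1 "real n"] by simp
  have lncn: "0 \<le> ln (c * real n)" "ln (c * real n) \<le> X"
    using cn cn1 unfolding X_def by auto
  have X_eq: "X = L + ln L - ln c + ln 2"
    using M0 L c unfolding X_def by (simp add: ln_mult ln_div L_def[symmetric])
  have ln2: "ln 2 \<le> (1::real)" using ln_le_minus_one[of 2] by simp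
  have "ln L \<le> ln c" using L c by simp
  then have X_le: "X \<le> L + 1" using X_eq ln2 by linarith
  have X0: "X \<ge> 0" using lncn by linarith
  have nk: "real n * real k \<le> M * ((1 + 1 / L) / c)"
  proof -
    have "real n * real k \<le> (M / S) * real k" using n_lt k_pos by (intro mult_right_mono) auto
    also have "\<dots> = M * (real k / S)" by simp
    also have "\<dots> \<le> M * ((1 + 1 / L) / c)" using kS M0 by (intro mult_left_mono) auto
    finally show ?thesis .
  qed
  have "real n * real k * ln (c * real n) \<le> M * ((1 + 1 / L) / c) * X"
    by (rule mult_mono[OF nk lncn(2) _ lncn(1)]) (use M0 L c in auto)
  also have "\<dots> = M * ((1 + 1 / L) * X / c)" by simp
  also have "\<dots> \<le> M * ((X + 4) / (c + 1))"
  proof (intro mult_left_mono)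
    have "X / L \<le> 2" using X_le L by (simp add: field_simps)
    then have "(1 + 1 / L) * X \<le> X + 2" by (simp add: field_simps)
    then have "(1 + 1 / L) * X / c \<le> (X + 2) / c" using c by (intro divide_right_mono) auto
    \<comment> \<open>Cross-multiplied this is \<open>X + 2 \<le> 2 * c\<close>, which follows from
      \<open>X \<le> L + 1\<close> and \<open>L < c / 2\<close>.\<close>
    also have "\<dots> \<le> (X + 4) / (c + 1)"
      using X_le L c by (simp add: field_simps)
    finally show "(1 + 1 / L) * X / c \<le> (X + 4) / (c + 1)" .
  qed (use M0 in auto)
  finally have main: "real n * real k * ln (c * real n) \<le> M * ((X + 4) / (c + 1))" .
  have "S \<le> M / (c + 1)" using S_small c by (simp add: field_simps)
  with main nS2 have
    "M - M / (c + 1) - M * ((X + 4) / (c + 1)) \<le> real n * S - real n * real k * ln (c * real n)"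
    by linarith
  moreover have "M - M / (c + 1) - M * ((X + 4) / (c + 1)) = M * (1 - (X + 5) / (c + 1))"
    by (simp add: algebra_simps add_divide_distrib)
  moreover have "M * (1 - (L + ln L - ln c + 6) / (c + 1)) \<le> M * (1 - (X + 5) / (c + 1))"
    using X_eq ln2 M0 c by (intro mult_left_mono diff_left_mono divide_right_mono) auto
  ultimately have "M * (1 - (L + ln L - ln c + 6) / (c + 1))
      \<le> real n * S - real n * real k * ln (c * real n)" by linarith
  then show ?thesis using F1 unfolding L_def by (meson exp_le_cancel_iff order_trans)
qed

theorem theorem5p10:
  fixes \<theta> a :: real
  assumes "0 < \<theta>" and "\<theta> < 1" and "a < a_star"
  shows "\<exists>\<alpha>>0. \<exists>c0>1. \<forall>c M :: real.
           c > 1 \<longrightarrow> M > 0 \<longrightarrow> c powr (1 - \<theta>) < ln M \<longrightarrow> ln M < c / 2 \<longrightarrow> c > c0 \<longrightarrow>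
           F c M > exp (M * (1 - (iter_ln 1 M + iter_ln 2 M + iter_ln 3 M) / (c + 1)
                              + (a - \<alpha> + iter_ln 1 c + iter_ln 2 c) / (c + 1)))"
proof -
  \<comment> \<open>\<open>\<bar>a\<bar>\<close> offsets \<open>a\<close>,
    \<open>- ln (1 - \<theta>)\<close> pays for comparing \<open>ln (ln (ln M))\<close> with
    \<open>ln (ln c)\<close>, and 7 exceeds the 6 of \<open>F_lower_bound\<close>, with room for
    strictness.\<close>
  define \<alpha> where "\<alpha> = 7 + \<bar>a\<bar> - ln (1 - \<theta>)"
  have ln\<theta>: "ln (1 - \<theta>) < 0" using assms by (simp add: ln_less_zero)
  have \<alpha>0: "\<alpha> > 0" unfolding \<alpha>_def using ln\<theta> by linarith
  have "1 - \<theta> > 0" using assms by simp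
  \<comment> \<open>Chosen so that \<open>M > c ^ 3 * exp 2\<close>, which exceeds
    \<open>c\<^sup>2 * (c + 1)\<close>, and so that \<open>ln M \<ge> 2\<close>.\<close>
  then have "eventually (\<lambda>c::real. 3 * ln c + 2 < c powr (1 - \<theta>)) at_top"
    by real_asymp
  then obtain c1 where c1: "\<And>c. c \<ge> c1 \<Longrightarrow> 3 * ln c + 2 < c powr (1 - \<theta>)"
    by (auto simp: eventually_at_top_linorder)
  have "F c M > exp (M * (1 - (iter_ln 1 M + iter_ln 2 M + iter_ln 3 M) / (c + 1)
                              + (a - \<alpha> + iter_ln 1 c + iter_ln 2 c) / (c + 1)))"
    if M: "M > 0" and lo: "c powr (1 - \<theta>) < ln M" and hi: "ln M < c / 2" and c: "c > max 4 c1"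
    for c M :: real
  proof -
    have c4: "c > 4" and big: "3 * ln c + 2 < ln M" using c c1[of c] lo by auto
    have lnc: "ln c > 0" using c4 by simp
    have L2: "ln M \<ge> 2" using big lnc by linarith
    have "c\<^sup>2 * (c + 1) \<le> c\<^sup>2 * (c * 2)" using c4 by (intro mult_left_mono) auto
    also have "\<dots> = c ^ 3 * 2" by (simp add: power2_eq_square power3_eq_cube)
    also have "\<dots> \<le> exp (3 * ln c) * exp 2"
    proof (intro mult_mono)
      have "exp (3 * ln c) = exp (ln c) ^ 3" using exp_of_nat_mult[of 3 "ln c"] by simp
      then show "c ^ 3 \<le> exp (3 * ln c)" using c4 by simp
      show "2 \<le> exp (2::real)" using exp_ge_add_one_self[of "2::real"] by linarith
    qed auto
    also have "\<dots> < exp (ln M)" using big by (simp add: exp_add[symmetric])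
    also have "\<dots> = M" using M by simp
    finally have cM: "c\<^sup>2 * (c + 1) < M" .
    have bound: "F c M \<ge> exp (M * (1 - (ln M + ln (ln M) - ln c + 6) / (c + 1)))"
      using F_lower_bound[OF _ L2 hi cM] c4 by simp
    \<comment> \<open>Taking logarithms twice in the lower bound on \<open>ln M\<close> turns the
      exponent \<open>1 - \<theta>\<close> into the additive constant
      \<open>ln (1 - \<theta>)\<close>.\<close>
    have "(1 - \<theta>) * ln c = ln (c powr (1 - \<theta>))" using c4 by (simp add: ln_powr)
    also have "\<dots> < ln (ln M)" using lo c4 L2 by (intro ln_less_cancel_iff[THEN iffD2]) auto
    finally have "ln ((1 - \<theta>) * ln c) < ln (ln (ln M))"
      using lnc assms by (intro ln_less_cancel_iff[THEN iffD2]) (auto intro: order_less_trans[rotated])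
    then have lll: "ln (1 - \<theta>) + ln (ln c) < ln (ln (ln M))"
      using lnc assms by (simp add: ln_mult)
    have "1 - (iter_ln 1 M + iter_ln 2 M + iter_ln 3 M) / (c + 1)
            + (a - \<alpha> + iter_ln 1 c + iter_ln 2 c) / (c + 1)
        = 1 - (ln M + ln (ln M) + ln (ln (ln M)) - (a - \<alpha> + ln c + ln (ln c))) / (c + 1)"
      by (simp add: numeral_2_eq_2 numeral_3_eq_3 diff_divide_distrib)
    also have "\<dots> < 1 - (ln M + ln (ln M) - ln c + 6) / (c + 1)"
      using lll c4 unfolding \<alpha>_def
      by (intro diff_strict_left_mono divide_strict_right_mono) auto
    finally show ?thesis
      using bound M by (smt (verit) exp_less_mono mult_strict_left_mono)
  qed
  then show ?thesis using \<alpha>0 by (intro exI[of _ \<alpha>] conjI exI[of _ "max 4 c1"]) auto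
qed

end
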